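(* Let $p$ be a prime and $k$ a positive integer. Then $p\nmid S(pk,k)$ if and only if $k$ is $p$-Fibbinary.
   Context: $S(n,k)$ is the Stirling number of the second kind. A nonnegative integer $k$ is called $p$-Fibbinary if the sum of any two consecutive digits of the base-$p$ representation of $k$ is at most $p-1$ (for $p=2$ this means the binary representation has no two consecutive ones). *)

theory Defs
  imports "HOL-Combinatorics.Stirling" "HOL-Computational_Algebra.Primes"
begin

definition base_digit :: "nat \<Rightarrow> nat \<Rightarrow> nat \<Rightarrow> nat" where
  "base_digit p k i = (k div p ^ i) mod p"

text \<open>
  The index ranges over all positions, including the zeros in front of the
  leading digit. For \<open>p \<ge> 2\<close> these impose no extra condition, since a single digit
  is always at most \<open>p - 1\<close>.
\<close>

definition p_Fibbinary :: "nat \<Rightarrow> nat \<Rightarrow> bool" where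
  "p_Fibbinary p k \<longleftrightarrow> (\<forall>i. base_digit p k i + base_digit p k (Suc i) \<le> p - 1)"

end

theory Submission
  imports Defs "HOL-Number_Theory.Residues"
begin

text \<open>
  Modulo \<open>p\<close> the polynomial \<open>x (x - 1) \<dots> (x - p + 1)\<close> is \<open>x\<^sup>p - x\<close>, which on Stirling numbers reads
  \<open>S(n + p, k + p) \<equiv> S(n + 1, k + p) + S(n, k)\<close>. Along the arithmetic progressions
  \<open>T(q, t) = S(q p + r + (p - 1) t, q p + r)\<close> this is Pascal's rule, so that \<open>T(q, t)\<close> is a
  binomial coefficient. At \<open>t = k = q p + r\<close> it gives \<open>S(p k, k) \<equiv> C(k + q, q)\<close> with
  \<open>q = \<lfloor>k / p\<rfloor>\<close>. By Lucas's theorem this is nonzero modulo \<open>p\<close> iff there is no carry when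
  adding \<open>k\<close> and \<open>q\<close> in base \<open>p\<close>. As the digits of \<open>q\<close> are those of \<open>k\<close> shifted by one place,
  this is the Fibbinary condition.
\<close>

section \<open>Falling factorials and S(p, k) modulo p\<close>

text \<open>\<open>fact k * (a choose k)\<close> is the falling factorial of \<open>a\<close> with
  \<open>k\<close> factors. Multiplying it by \<open>a = k + (a - k)\<close> reproduces the Stirling
  recurrence.\<close>

lemma power_eq_sum_Stirling:
  fixes a n :: nat
  shows "a ^ n = (\<Sum>k\<le>n. Stirling n k * (fact k * (a choose k)))"
proof (induction n)
  case 0
  then show ?case by simp
next
  case (Suc n)
  define F :: "nat \<Rightarrow> nat" where "F k = fact k * (a choose k)" for k
  have aF: "a * F k = k * F k + F (Suc k)" for k
  proof -
    have "Suc k * (a choose Suc k) = (a - k) * (a choose k)"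
      by (metis binomial_absorb_comp binomial_absorption)
    \<comment> \<open>For \<open>k > a\<close> the subtraction truncates, but then
      \<open>a choose k\<close> is 0.\<close>
    moreover have "a * (a choose k) = k * (a choose k) + (a - k) * (a choose k)"
      by (cases "k \<le> a") (simp_all flip: add_mult_distrib)
    ultimately have "a * (a choose k) = k * (a choose k) + Suc k * (a choose Suc k)"
      by simp
    then have "fact k * (a * (a choose k)) = fact k * (k * (a choose k) + Suc k * (a choose Suc k))"
      by (rule arg_cong)
    then show ?thesis
      by (simp add: F_def algebra_simps)
  qed
  \<comment> \<open>The index shift loses nothing: the term at 0 has factor 0, and
    \<open>Stirling n (Suc n) = 0\<close>.\<close>
  have shift: "(\<Sum>k\<le>n. k * Stirling n k * F k) = (\<Sum>k\<le>n. Suc k * Stirling n (Suc k) * F (Suc k))"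
  proof -
    have "(\<Sum>k\<le>n. k * Stirling n k * F k) = (\<Sum>k\<le>Suc n. k * Stirling n k * F k)"
      by simp
    also have "\<dots> = (\<Sum>k\<le>n. Suc k * Stirling n (Suc k) * F (Suc k))"
      by (subst sum.atMost_Suc_shift) simp
    finally show ?thesis .
  qed
  have "a ^ Suc n = (\<Sum>k\<le>n. Stirling n k * (a * F k))"
    using Suc by (simp add: F_def sum_distrib_left mult_ac)
  also have "\<dots> = (\<Sum>k\<le>n. k * Stirling n k * F k) + (\<Sum>k\<le>n. Stirling n k * F (Suc k))"
    unfolding aF by (simp add: algebra_simps sum.distrib)
  also have "\<dots> = (\<Sum>k\<le>n. Stirling (Suc n) (Suc k) * F (Suc k))"
    unfolding shift by (simp add: algebra_simps sum.distrib)
  also have "\<dots> = (\<Sum>k\<le>Suc n. Stirling (Suc n) k * F k)"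
    by (subst sum.atMost_Suc_shift) simp
  finally show ?case by (simp only: F_def)
qed

lemma fermat_little_nat:
  fixes p a :: nat
  assumes "prime p"
  shows "[a ^ p = a] (mod p)"
proof (cases "p dvd a")
  case True
  then have "p dvd a ^ p"
    using assms by (metis dvd_power_le dvd_trans dvd_power prime_gt_0_nat)
  with True show ?thesis by (simp add: cong_def)
next
  case False
  then have "[a ^ (p - 1) = 1] (mod p)"
    using assms fermat_theorem by blast
  then have "[a * a ^ (p - 1) = a * 1] (mod p)"
    by (rule cong_scalar_left)
  then show ?thesis
    using assms by (simp add: prime_gt_0_nat flip: power_Suc)
qed

text \<open>Expand \<open>k ^ p\<close> in falling factorials of \<open>k\<close>. The terms with
  \<open>j > k\<close> vanish, those with \<open>2 \<le> j < k\<close> are divisible by induction,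
  and \<open>j = 1\<close> gives \<open>k\<close>. Fermat then leaves
  \<open>p dvd Stirling p k * fact k\<close>, where \<open>fact k\<close> is prime to
  \<open>p\<close>.\<close>

lemma prime_dvd_Stirling_prime:
  fixes p k :: nat
  assumes "prime p" "2 \<le> k" "k < p"
  shows "p dvd Stirling p k"
  using assms(2,3)
proof (induction k rule: less_induct)
  case (less k)
  define f where "f j = Stirling p j * (fact j * (k choose j))" for j
  have rest: "p dvd (\<Sum>j\<in>{..p} - {1} - {k}. f j)"
  proof (rule dvd_sum)
    fix j assume j: "j \<in> {..p} - {1} - {k}"
    consider "j = 0" | "2 \<le> j" "j < k" | "k < j"
      using j by force
    then show "p dvd f j"
    proof cases
      case 1
      then show ?thesis using less.prems by (cases p) (auto simp: f_def)
    next
      case 2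
      then show ?thesis using less by (simp add: f_def)
    next
      case 3
      then show ?thesis by (simp add: f_def binomial_eq_0)
    qed
  qed
  have "Stirling p 1 = 1"
    using less.prems by (cases p) (auto simp del: Stirling.simps)
  then have f1: "f 1 = k"
    by (simp add: f_def)
  have "k ^ p = (\<Sum>j\<le>p. f j)"
    unfolding f_def by (rule power_eq_sum_Stirling)
  also have "\<dots> = f 1 + (f k + (\<Sum>j\<in>{..p} - {1} - {k}. f j))"
    using less.prems by (simp add: sum.remove[of _ 1] sum.remove[of _ k])
  finally have "k ^ p = k + (f k + (\<Sum>j\<in>{..p} - {1} - {k}. f j))"
    unfolding f1 .
  then have "[k + (f k + (\<Sum>j\<in>{..p} - {1} - {k}. f j)) = k + 0] (mod p)"
    using fermat_little_nat[OF assms(1), of k] by simp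
  then have "p dvd f k + (\<Sum>j\<in>{..p} - {1} - {k}. f j)"
    by (simp only: cong_add_lcancel_nat cong_0_iff)
  then have "p dvd Stirling p k * fact k"
    using rest by (simp add: dvd_add_left_iff f_def)
  moreover have "\<not> p dvd fact k"
    using less.prems assms(1) by (simp add: prime_dvd_fact_iff)
  ultimately show ?case
    using assms(1) prime_dvd_mult_iff by blast
qed

section \<open>Shifting the upper index by p\<close>

text \<open>The Stirling recurrence carries the case \<open>n = 0\<close> to all \<open>n\<close>;
  it never leaves the range \<open>k < p\<close>.\<close>

lemma Stirling_add_prime_cong_lower:
  fixes p n k :: nat
  assumes "prime p" "k < p"
  shows "[Stirling (n + p) k = Stirling (n + 1) k] (mod p)"
  using assms(2)
proof (induction n arbitrary: k)
  case 0
  have "p > 0" using 0 by simp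
  consider "k = 0" | "k = 1" | "2 \<le> k" by linarith
  then show ?case
  proof cases
    case 1
    then show ?thesis using \<open>p > 0\<close> by (cases p) auto
  next
    case 2
    then show ?thesis using \<open>p > 0\<close> by (cases p) (auto simp del: Stirling.simps)
  next
    case 3
    then show ?thesis
      using prime_dvd_Stirling_prime[OF assms(1) 3 0] by (simp add: cong_0_iff)
  qed
next
  case (Suc n)
  show ?case
  proof (cases k)
    case 0
    then show ?thesis by simp
  next
    case (Suc j)
    have "[Suc j * Stirling (n + p) (Suc j) + Stirling (n + p) j
          = Suc j * Stirling (n + 1) (Suc j) + Stirling (n + 1) j] (mod p)"
      using Suc.IH[of j] Suc.IH[of "Suc j"] Suc.prems Suc
      by (intro cong_add cong_scalar_left) auto
    then show ?thesis using Suc by simp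
  qed
qed

text \<open>Induction on \<open>n\<close> through the Stirling recurrence, whose coefficient
  \<open>k + p\<close> acts as \<open>k\<close> modulo \<open>p\<close>.\<close>

lemma Stirling_add_prime_cong:
  fixes p n k :: nat
  assumes "prime p"
  shows "[Stirling (n + p) (k + p) = Stirling (n + 1) (k + p) + Stirling n k] (mod p)"
proof (induction n arbitrary: k)
  case 0
  show ?case
    using prime_ge_2_nat[OF assms] by (cases k) auto
next
  case (Suc n)
  show ?case
  proof (cases k)
    case 0
    obtain m where m: "p = Suc m"
      using prime_gt_0_nat[OF assms] by (cases p) auto
    have "[p * Stirling (n + p) p = p * Stirling (n + 1) p] (mod p)"
      by (simp add: cong_def)
    \<comment> \<open>The recurrence at lower index \<open>p\<close> reaches down to
      \<open>p - 1\<close>, outside the induction hypothesis.\<close>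
    moreover have "[Stirling (n + p) m = Stirling (n + 1) m] (mod p)"
      using m by (intro Stirling_add_prime_cong_lower[OF assms]) simp
    ultimately have "[p * Stirling (n + p) p + Stirling (n + p) m
          = p * Stirling (n + 1) p + Stirling (n + 1) m] (mod p)"
      by (rule cong_add)
    moreover have "Stirling (Suc n + p) p = p * Stirling (n + p) p + Stirling (n + p) m"
      using m by simp
    moreover have "Stirling (Suc n + 1) p = p * Stirling (n + 1) p + Stirling (n + 1) m"
      using m by simp
    ultimately show ?thesis using 0 by simp
  next
    case (Suc j)
    have "[(Suc j + p) * Stirling (n + p) (Suc j + p) + Stirling (n + p) (j + p)
          = (Suc j + p) * (Stirling (n + 1) (Suc j + p) + Stirling n (Suc j))
            + (Stirling (n + 1) (j + p) + Stirling n j)] (mod p)"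
      by (intro cong_add cong_scalar_left Suc.IH)
    \<comment> \<open>The recurrence for \<open>Stirling (Suc n) (Suc j)\<close> has coefficient
      \<open>Suc j\<close>; the surplus is a multiple of \<open>p\<close>.\<close>
    also have "(Suc j + p) * (Stirling (n + 1) (Suc j + p) + Stirling n (Suc j))
            + (Stirling (n + 1) (j + p) + Stirling n j)
        = (Stirling (Suc n + 1) (Suc j + p) + Stirling (Suc n) (Suc j)) + p * Stirling n (Suc j)"
      by (simp add: algebra_simps)
    also have "[\<dots> = Stirling (Suc n + 1) (Suc j + p) + Stirling (Suc n) (Suc j)] (mod p)"
      by (simp add: cong_def)
    finally show ?thesis using Suc by simp
  qed
qed

section \<open>Pascal's rule along arithmetic progressions\<close>

lemma Stirling_progression_Suc_cong:
  fixes p q r t :: nat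
  assumes "prime p"
  shows "[Stirling (Suc q * p + r + (p - 1) * Suc t) (Suc q * p + r)
        = Stirling (Suc q * p + r + (p - 1) * t) (Suc q * p + r)
          + Stirling (q * p + r + (p - 1) * Suc t) (q * p + r)] (mod p)"
proof -
  obtain m where m: "p = Suc m"
    using prime_gt_0_nat[OF assms] by (cases p) auto
  have "[Stirling ((q * p + r + (p - 1) * Suc t) + p) (q * p + r + p)
        = Stirling ((q * p + r + (p - 1) * Suc t) + 1) (q * p + r + p)
          + Stirling (q * p + r + (p - 1) * Suc t) (q * p + r)] (mod p)"
    by (rule Stirling_add_prime_cong[OF assms])
  moreover have "(q * p + r + (p - 1) * Suc t) + p = Suc q * p + r + (p - 1) * Suc t"
    by (simp add: algebra_simps)
  moreover have "(q * p + r + (p - 1) * Suc t) + 1 = Suc q * p + r + (p - 1) * t"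
    by (simp add: m algebra_simps)
  moreover have "q * p + r + p = Suc q * p + r" by simp
  ultimately show ?thesis by metis
qed

text \<open>Pascal's rule with both boundaries equal to 1: \<open>t = 0\<close> lies on the
  diagonal, and \<open>q = 0\<close> is constant in \<open>t\<close> because
  \<open>r < p\<close>.\<close>

lemma Stirling_progression_cong_residue:
  fixes p q r t :: nat
  assumes "prime p" "0 < r" "r < p"
  shows "[Stirling (q * p + r + (p - 1) * t) (q * p + r) = (t + q) choose q] (mod p)"
proof (induction q arbitrary: t)
  case 0
  show ?case
  proof (induction t)
    case 0
    then show ?case by simp
  next
    case (Suc t)
    \<comment> \<open>Since \<open>r > 0\<close>, adding \<open>p\<close> or 1 to
      \<open>r - 1 + (p - 1) * t\<close> gives neighbouring terms of the progression.\<close>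
    have "[Stirling ((r - 1 + (p - 1) * t) + p) r = Stirling ((r - 1 + (p - 1) * t) + 1) r] (mod p)"
      by (rule Stirling_add_prime_cong_lower[OF assms(1,3)])
    moreover have "(r - 1 + (p - 1) * t) + p = r + (p - 1) * Suc t"
      using assms by (cases r; cases p) auto
    moreover have "(r - 1 + (p - 1) * t) + 1 = r + (p - 1) * t"
      using assms by simp
    ultimately show ?case
      using Suc by (auto intro: cong_trans)
  qed
next
  case (Suc q)
  show ?case
  proof (induction t)
    case 0
    then show ?case by (simp del: Stirling.simps)
  next
    case (Suc t)
    have "[Stirling (Suc q * p + r + (p - 1) * Suc t) (Suc q * p + r)
        = (t + Suc q choose Suc q) + (Suc t + q choose q)] (mod p)"
      by (rule cong_trans[OF Stirling_progression_Suc_cong[OF assms(1)]])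
        (intro cong_add Suc.IH \<open>\<And>t. [Stirling (q * p + r + (p - 1) * t) (q * p + r) = t + q choose q] (mod p)\<close>)
    then show ?case by (simp add: add.commute)
  qed
qed

text \<open>For \<open>r = 0\<close> the bottom row is \<open>Stirling ((p - 1) * t) 0\<close>,
  which is 0 for \<open>t > 0\<close>. Hence the row of ones is the next one, and the binomial index
  drops by one.\<close>

lemma Stirling_progression_cong_multiple:
  fixes p q t :: nat
  assumes "prime p"
  shows "[Stirling (Suc q * p + (p - 1) * t) (Suc q * p) = (t + q) choose q] (mod p)"
proof (induction q arbitrary: t)
  case 0
  show ?case
  proof (induction t)
    case 0
    then show ?case by simp
  next
    case (Suc t)
    have "(p - 1) * Suc t \<noteq> 0"
      using prime_ge_2_nat[OF assms] by simp
    then have "Stirling ((p - 1) * Suc t) 0 = 0"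
      by (metis Stirling.simps(3) not0_implies_Suc)
    then show ?case
      using cong_trans[OF Stirling_progression_Suc_cong[OF assms, of 0 0 t]] Suc by simp
  qed
next
  case (Suc q)
  show ?case
  proof (induction t)
    case 0
    then show ?case by (simp del: Stirling.simps)
  next
    case (Suc t)
    have "[Stirling (Suc (Suc q) * p + 0 + (p - 1) * Suc t) (Suc (Suc q) * p + 0)
        = (t + Suc q choose Suc q) + (Suc t + q choose q)] (mod p)"
      by (rule cong_trans[OF Stirling_progression_Suc_cong[OF assms]],
          unfold add_0_right)
        (intro cong_add Suc.IH \<open>\<And>t. [Stirling (Suc q * p + (p - 1) * t) (Suc q * p) = t + q choose q] (mod p)\<close>)
    then show ?case by (simp add: add.commute)
  qed
qed

text \<open>Both cases take \<open>t = k\<close>, since \<open>p * k = k + (p - 1) * k\<close>. If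
  \<open>p\<close> divides \<open>k\<close>, the dropped index must still be reconciled with
  \<open>k div p\<close>.\<close>

lemma Stirling_mult_prime_cong:
  fixes p k :: nat
  assumes "prime p" "0 < k"
  shows "[Stirling (p * k) k = (k + k div p) choose (k div p)] (mod p)"
proof -
  define q r where "q = k div p" and "r = k mod p"
  have p: "p > 0" "r < p"
    using assms by (auto simp: r_def prime_gt_0_nat)
  have k: "k = q * p + r" by (simp add: q_def r_def)
  have pk: "p * k = k + (p - 1) * k"
    using p by (cases p) auto
  show ?thesis
  proof (cases "r = 0")
    case False
    then show ?thesis
      using Stirling_progression_cong_residue[OF assms(1), of r q k] p pk k
      by (simp flip: q_def)
  next
    case True
    with assms k obtain m where m: "q = Suc m"
      by (cases q) auto
    \<comment> \<open>Here \<open>(p + 1) * C(k + m, m) = C(k + q, q)\<close>, because \<open>k = p q\<close>.\<close>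
    have "q * ((k + q) choose q) = q * ((p + 1) * ((k + m) choose m))"
      using Suc_times_binomial_eq[of "k + m" m] True k
      by (simp add: m algebra_simps)
    moreover have "q \<noteq> 0"
      using m by simp
    ultimately have "(k + q) choose q = (p + 1) * ((k + m) choose m)"
      by (simp only: mult_cancel1) simp
    then have "[(k + q) choose q = (k + m) choose m] (mod p)"
      by (simp add: cong_def)
    moreover have "[Stirling (p * k) k = (k + m) choose m] (mod p)"
      using Stirling_progression_cong_multiple[OF assms(1), of m k] True k pk m by simp
    ultimately show ?thesis
      unfolding q_def[symmetric] by (metis cong_sym cong_trans)
  qed
qed

section \<open>Lucas's theorem, one digit at a time\<close>

text \<open>In Vandermonde's sum, \<open>p choose i\<close> survives modulo \<open>p\<close> only at
  \<open>i = 0\<close> and \<open>i = p\<close>.\<close>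

lemma binomial_add_prime_cong:
  fixes p n m :: nat
  assumes "prime p"
  shows "[(p + n) choose m = (n choose m) + (if p \<le> m then n choose (m - p) else 0)] (mod p)"
proof -
  define f where "f i = (p choose i) * (n choose (m - i))" for i
  have p: "p > 0" using assms by (simp add: prime_gt_0_nat)
  have "[f i = (if i = 0 then n choose m else 0) + (if i = p then n choose (m - p) else 0)] (mod p)" for i
  proof -
    consider "i = 0" | "i = p" | "0 < i" "i < p" | "p < i" by linarith
    then show ?thesis
    proof cases
      case 3
      then have "p dvd (p choose i)"
        using assms by (intro dvd_choose_prime) auto
      then show ?thesis using 3 by (simp add: f_def cong_0_iff)
    qed (use p in \<open>auto simp: f_def binomial_eq_0\<close>)
  qed
  then have "[(\<Sum>i\<le>m. f i) = (\<Sum>i\<le>m. (if i = 0 then n choose m else 0)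
      + (if i = p then n choose (m - p) else 0))] (mod p)"
    by (intro cong_sum) auto
  then show ?thesis
    by (simp add: f_def vandermonde sum.distrib sum.delta)
qed

text \<open>Adding \<open>p\<close> to the upper index is one step of Pascal's rule for
  \<open>a choose c\<close>. For \<open>c = 0\<close> the second term is absent because
  \<open>d < p\<close>.\<close>

lemma binomial_Lucas_step:
  fixes p a b c d :: nat
  assumes "prime p" "b < p" "d < p"
  shows "[(p * a + b) choose (p * c + d) = (a choose c) * (b choose d)] (mod p)"
proof (induction a arbitrary: c)
  case 0
  show ?case
    using assms(2) by (cases c) (auto simp: binomial_eq_0)
next
  case (Suc a)
  have step: "[(p * Suc a + b) choose (p * c + d) = ((p * a + b) choose (p * c + d))
      + (if p \<le> p * c + d then (p * a + b) choose (p * c + d - p) else 0)] (mod p)"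
    using binomial_add_prime_cong[OF assms(1), of "p * a + b"] by (simp add: add.assoc)
  show ?case
  proof (cases c)
    case 0
    then show ?thesis
      using step Suc[of 0] assms(3) by (auto intro: cong_trans)
  next
    case (Suc e)
    have "[((p * a + b) choose (p * c + d)) + ((p * a + b) choose (p * e + d))
        = (a choose c) * (b choose d) + (a choose e) * (b choose d)] (mod p)"
      by (intro cong_add Suc.IH)
    moreover have "p \<le> p * c + d" "p * c + d - p = p * e + d"
      using Suc by simp_all
    ultimately show ?thesis
      using step Suc by (simp add: algebra_simps) (metis cong_trans)
  qed
qed

section \<open>Carries and the Fibbinary condition\<close>

text \<open>Peeling off the lowest pair of digits matches one Lucas step.\<close>

lemma p_Fibbinary_iff:
  "p_Fibbinary p k \<longleftrightarrow> k mod p + (k div p) mod p \<le> p - 1 \<and> p_Fibbinary p (k div p)"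
proof -
  have Suc_digit: "base_digit p k (Suc i) = base_digit p (k div p) i" for i
    by (simp add: base_digit_def div_mult2_eq)
  have all_nat: "(\<forall>i. P i) \<longleftrightarrow> P 0 \<and> (\<forall>i. P (Suc i))" for P :: "nat \<Rightarrow> bool"
    by (metis not0_implies_Suc)
  show ?thesis
    unfolding p_Fibbinary_def
    by (subst all_nat) (simp only: Suc_digit, simp add: base_digit_def)
qed

text \<open>The lowest digits of \<open>k\<close> and \<open>q = k div p\<close> are
  \<open>r\<close> and \<open>s\<close>. Without a carry, a Lucas step passes from \<open>k\<close>
  to \<open>q\<close>; with a carry, it produces a zero factor.\<close>

lemma prime_dvd_binomial_shift_iff:
  fixes p k :: nat
  assumes "prime p"
  shows "\<not> p dvd ((k + k div p) choose (k div p)) \<longleftrightarrow> p_Fibbinary p k"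
proof (induction k rule: less_induct)
  case (less k)
  show ?case
  proof (cases "k = 0")
    case True
    then show ?thesis
      using assms by (auto simp: p_Fibbinary_def base_digit_def)
  next
    case False
    define q r s u where "q = k div p" and "r = k mod p" and "s = q mod p" and "u = q div p"
    have p: "p > 0" "r < p" "s < p"
      using assms by (auto simp: r_def s_def prime_gt_0_nat)
    have q: "q = p * u + s" by (simp add: s_def u_def)
    have kq: "k + q = p * (q + u) + (r + s)"
      by (simp add: q_def r_def s_def u_def algebra_simps)
    have IH: "\<not> p dvd ((q + u) choose u) \<longleftrightarrow> p_Fibbinary p q"
      unfolding u_def using less[of q] False prime_gt_1_nat[OF assms] by (simp add: q_def)
    have fib: "p_Fibbinary p k \<longleftrightarrow> r + s \<le> p - 1 \<and> p_Fibbinary p q"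
      unfolding q_def r_def s_def by (rule p_Fibbinary_iff)
    show ?thesis
    proof (cases "r + s < p")
      case True
      have "[(k + q) choose q = ((q + u) choose u) * ((r + s) choose s)] (mod p)"
        unfolding kq by (subst (2) q) (rule binomial_Lucas_step[OF assms True p(3)])
      then have "p dvd ((k + q) choose q) \<longleftrightarrow> p dvd ((q + u) choose u) * ((r + s) choose s)"
        by (rule cong_dvd_iff)
      \<comment> \<open>The binomial divides \<open>fact (r + s)\<close>, and
        \<open>r + s < p\<close>.\<close>
      moreover have "\<not> p dvd ((r + s) choose s)"
      proof
        assume "p dvd ((r + s) choose s)"
        then have "p dvd fact (r + s)"
          using binomial_fact_lemma[of s "r + s"] by (metis dvd_mult le_add2)
        then show False
          using assms True by (simp add: prime_dvd_fact_iff)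
      qed
      ultimately show ?thesis
        using IH fib True assms
        by (auto simp: prime_dvd_mult_iff simp flip: q_def)
    next
      case False
      \<comment> \<open>After the carry the lowest digit is \<open>r + s - p\<close>, which is below
        \<open>s\<close> because \<open>r < p\<close>.\<close>
      have "k + q = p * (q + u + 1) + (r + s - p)"
        using kq False by (simp add: algebra_simps)
      then have "[(k + q) choose q = ((q + u + 1) choose u) * ((r + s - p) choose s)] (mod p)"
        using binomial_Lucas_step[OF assms _ p(3), of "r + s - p" "q + u + 1" u] p q by simp
      moreover have "(r + s - p) choose s = 0"
        using False p by (intro binomial_eq_0) auto
      ultimately have "p dvd ((k + q) choose q)"
        by (simp add: cong_0_iff)
      then show ?thesis
        using fib False p by (auto simp flip: q_def)
    qed
  qed
qed

theorem theorem2p4: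
  fixes p k :: nat
  assumes "prime p" and "k > 0"
  shows "\<not> p dvd Stirling (p * k) k \<longleftrightarrow> p_Fibbinary p k"
  using cong_dvd_iff[OF Stirling_mult_prime_cong[OF assms]]
    prime_dvd_binomial_shift_iff[OF assms(1)] by simp

end
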